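(* Let $m,n$ be positive integers and $a,b$ non-negative integers with $a+b=n$ and $a$ even. Let $x_1,\ldots,x_a,y_1,\ldots,y_b$ be complex numbers with $x_1+\cdots+x_a+y_1+\cdots+y_b=0$. Define \[ R_{2,4}(m,n;\tau)= mn\, q^{\frac{a}{4}}\sum_{\substack{r_1,\ldots,r_a,s_1,\ldots,s_b\in\mathbb{Z}\\ 2(r_1+\cdots+r_a+s_1+\cdots+s_b)+a=0}}(-1)^{s_1+\cdots+s_b}q^{r_1^2+\cdots+r_a^2+s_1^2+\cdots+s_b^2+r_1+\cdots+r_a}e^{i(2r_1x_1+\cdots+2r_ax_a+2s_1y_1+\cdots+2s_by_b+x_1+\cdots+x_a)}. \] Let $S(z)=\sum_{k=0}^{mn-1}\prod_{j=1}^{a}\vartheta_2\!\left(z+x_j+\tfrac{k\pi}{mn}\Big|\tau\right)\prod_{i=1}^{b}\vartheta_4\!\left(z+y_i+\tfrac{k\pi}{mn}\Big|\tau\right)$. Then for all $z\in\mathbb{C}$: if $mb$ is even, $S(z)=R_{2,4}(m,n;\tau)\,\vartheta_3(mnz\,|\,m^2n\tau)$; if $mb$ is odd, $S(z)=R_{2,4}(m,n;\tau)\,\vartheta_4(mnz\,|\,m^2n\tau)$.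
   Context: Throughout, $\tau\in\mathbb{C}$ with $\Im(\tau)>0$, $q=e^{\pi i\tau}$, and $q^{\alpha}$ means $e^{\pi i\alpha\tau}$ for real $\alpha$. The Jacobi theta functions are $\vartheta_1(z|\tau)=-iq^{1/4}\sum_{n\in\mathbb{Z}}(-1)^nq^{n(n+1)}e^{(2n+1)iz}$, $\vartheta_2(z|\tau)=q^{1/4}\sum_{n\in\mathbb{Z}}q^{n(n+1)}e^{(2n+1)iz}$, $\vartheta_3(z|\tau)=\sum_{n\in\mathbb{Z}}q^{n^2}e^{2niz}$, $\vartheta_4(z|\tau)=\sum_{n\in\mathbb{Z}}(-1)^nq^{n^2}e^{2niz}$; and $\vartheta_j(z|m^2n\tau)$ denotes the same function with $\tau$ replaced by $m^2n\tau$. An empty product equals $1$. *)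

theory Defs
  imports "HOL-Analysis.Analysis"
begin

text \<open>The power \<open>q\<^sup>\<alpha>\<close> of the nome \<open>q = e\<^bsup>\<pi>i\<tau>\<^esup>\<close>, which depends on \<open>\<tau>\<close> and not only on \<open>q\<close>.\<close>

definition qpow :: "complex \<Rightarrow> real \<Rightarrow> complex" where
  "qpow \<tau> \<alpha> = exp (of_real pi * \<i> * of_real \<alpha> * \<tau>)"

definition theta2 :: "complex \<Rightarrow> complex \<Rightarrow> complex" where
  "theta2 z \<tau> = qpow \<tau> (1/4) *
     (\<Sum>\<^sub>\<infinity>n::int. qpow \<tau> (of_int (n * (n + 1))) * exp (of_int (2 * n + 1) * \<i> * z))"

definition theta3 :: "complex \<Rightarrow> complex \<Rightarrow> complex" where
  "theta3 z \<tau> = (\<Sum>\<^sub>\<infinity>n::int. qpow \<tau> (of_int (n\<^sup>2)) * exp (of_int (2 * n) * \<i> * z))"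

definition theta4 :: "complex \<Rightarrow> complex \<Rightarrow> complex" where
  "theta4 z \<tau> =
     (\<Sum>\<^sub>\<infinity>n::int. (-1) powi n * qpow \<tau> (of_int (n\<^sup>2)) * exp (of_int (2 * n) * \<i> * z))"

text \<open>Integer tuples \<open>(r\<^sub>1,\<dots>,r\<^sub>a)\<close>, \<open>(s\<^sub>1,\<dots>,s\<^sub>b)\<close> are functions that are \<open>undefined\<close> outside
  \<open>{1..a}\<close>, \<open>{1..b}\<close>, so that each tuple is counted exactly once.\<close>

definition R24_index :: "nat \<Rightarrow> nat \<Rightarrow> ((nat \<Rightarrow> int) \<times> (nat \<Rightarrow> int)) set" where
  "R24_index a b = {(r, s). r \<in> {1..a} \<rightarrow>\<^sub>E UNIV \<and> s \<in> {1..b} \<rightarrow>\<^sub>E UNIV \<and>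
     2 * ((\<Sum>j=1..a. r j) + (\<Sum>i=1..b. s i)) + int a = 0}"

definition R24 :: "nat \<Rightarrow> nat \<Rightarrow> nat \<Rightarrow> nat \<Rightarrow> (nat \<Rightarrow> complex) \<Rightarrow> (nat \<Rightarrow> complex) \<Rightarrow> complex \<Rightarrow> complex"
  where
  "R24 m n a b x y \<tau> = of_nat (m * n) * qpow \<tau> (real a / 4) *
     (\<Sum>\<^sub>\<infinity>(r, s)\<in>R24_index a b.
        (-1) powi (\<Sum>i=1..b. s i) *
        qpow \<tau> (of_int ((\<Sum>j=1..a. (r j)\<^sup>2) + (\<Sum>i=1..b. (s i)\<^sup>2) + (\<Sum>j=1..a. r j))) *
        exp (\<i> * ((\<Sum>j=1..a. 2 * of_int (r j) * x j) + (\<Sum>i=1..b. 2 * of_int (s i) * y i)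
                  + (\<Sum>j=1..a. x j))))"

definition S24 :: "nat \<Rightarrow> nat \<Rightarrow> nat \<Rightarrow> nat \<Rightarrow> (nat \<Rightarrow> complex) \<Rightarrow> (nat \<Rightarrow> complex) \<Rightarrow> complex \<Rightarrow>
    complex \<Rightarrow> complex" where
  "S24 m n a b x y \<tau> z = (\<Sum>k<m * n.
     (\<Prod>j=1..a. theta2 (z + x j + of_nat k * of_real pi / of_nat (m * n)) \<tau>) *
     (\<Prod>i=1..b. theta4 (z + y i + of_nat k * of_real pi / of_nat (m * n)) \<tau>))"

end

theory Submission
  imports Defs
begin

text \<open>
  Multiply out the theta series: the product becomes a sum over integer tuples \<open>(r, s)\<close> whose
  terms depend on \<open>z\<close> only through the factor \<open>exp (2 i N z)\<close>, where
  \<open>N = \<Sum>r + \<Sum>s + a/2\<close>. Averaging over the shifts of \<open>z\<close> by \<open>k \<pi> / (m n)\<close> kills all terms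
  except those with \<open>N = m n t\<close>. Since there are \<open>n\<close> coordinates, subtracting \<open>m t\<close> from each of
  them brings such a tuple to \<open>N = 0\<close>. The cross terms vanish because \<open>N = 0\<close> and because the
  \<open>x\<^sub>j\<close> and \<open>y\<^sub>i\<close> sum to zero, so the sum splits as \<open>R\<^sub>2\<^sub>,\<^sub>4\<close> times a theta series in \<open>t\<close> with sign
  \<open>(-1)\<close> to the power \<open>m b t\<close>.
\<close>

section \<open>Unconditional sums of products\<close>

text \<open>For complex families summability is absolute summability, so it suffices to sum norms,
  first along one factor and then along the other.\<close>

lemma summable_on_Times_mult:
  fixes f :: "'a \<Rightarrow> complex" and g :: "'b \<Rightarrow> complex"
  assumes "f summable_on A" and "g summable_on B"
  shows "(\<lambda>(x, y). f x * g y) summable_on A \<times> B"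
proof -
  have f: "(\<lambda>x. norm (f x)) summable_on A" and g: "(\<lambda>y. norm (g y)) summable_on B"
    using assms by (simp_all add: summable_on_iff_abs_summable_on_complex)
  have "(\<lambda>p. norm (case p of (x, y) \<Rightarrow> f x * g y)) summable_on A \<times> B"
    unfolding Infinite_Sum.abs_summable_on_Sigma_iff
    using f g
    by (auto simp: norm_mult abs_mult infsum_cmult_right' intro!: summable_on_cmult_right summable_on_cmult_left)
  then show ?thesis
    by (simp only: summable_on_iff_abs_summable_on_complex)
qed

text \<open>Fubini needs only joint summability. Constants leave an \<open>infsum\<close> over a
  field without a convergence condition, so no separate summability of \<open>f\<close> and
  \<open>g\<close> has to be supplied.\<close>

lemma infsum_Times_mult:
  fixes f :: "'a \<Rightarrow> complex" and g :: "'b \<Rightarrow> complex"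
  assumes "(\<lambda>(x, y). f x * g y) summable_on A \<times> B"
  shows "(\<Sum>\<^sub>\<infinity>(x, y)\<in>A \<times> B. f x * g y) = infsum f A * infsum g B"
  using infsum_Sigma'_banach[OF assms]
  by (simp add: infsum_cmult_right' infsum_cmult_left')

lemma summable_on_prod_PiE:
  fixes f :: "'a \<Rightarrow> 'b \<Rightarrow> complex"
  assumes "finite A" and "\<And>x. x \<in> A \<Longrightarrow> f x summable_on B x"
  shows "(\<lambda>g. \<Prod>x\<in>A. f x (g x)) summable_on PiE A B"
  using assms
proof (induction A rule: finite_induct)
  case empty
  then show ?case by simp
next
  case (insert x A)
  \<comment> \<open>Since \<open>x\<close> is not in \<open>A\<close>, this map is injective on
    \<open>B x \<times> PiE A B\<close>, and its image is the set of functions on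
    \<open>insert x A\<close>; this reduces the claim to a product of two sums.\<close>
  let ?F = "\<lambda>(y, g). g(x := y)"
  have "(\<lambda>(y, g). f x y * (\<Prod>i\<in>A. f i (g i))) summable_on B x \<times> PiE A B"
    using insert by (intro summable_on_Times_mult) auto
  also have "?this \<longleftrightarrow> ((\<lambda>g. \<Prod>i\<in>insert x A. f i (g i)) \<circ> ?F) summable_on B x \<times> PiE A B"
    using insert.hyps by (intro summable_on_cong) (auto intro!: prod.cong)
  also have "\<dots> \<longleftrightarrow> (\<lambda>g. \<Prod>i\<in>insert x A. f i (g i)) summable_on ?F ` (B x \<times> PiE A B)"
    using insert.hyps by (intro summable_on_reindex[symmetric] inj_combinator)
  finally show ?case by (simp add: PiE_insert_eq)
qed

section \<open>Convergence of theta series\<close>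

text \<open>The integers are covered by two copies of the naturals, each carrying a geometric
  series. The overlap at 0 is harmless for summability.\<close>

lemma summable_on_exp_neg_abs_int: "(\<lambda>n::int. exp (- \<bar>real_of_int n\<bar>)) summable_on UNIV"
proof -
  have nat: "(\<lambda>n::nat. exp (- real n)) summable_on UNIV"
  proof (rule norm_summable_imp_summable_on)
    have "summable (\<lambda>n. exp (- 1 :: real) ^ n)" by (rule summable_geometric) simp
    then show "summable (\<lambda>n. norm (exp (- real n)))"
      by (simp add: exp_of_nat_mult[symmetric])
  qed
  have "(\<lambda>n. exp (- \<bar>real_of_int n\<bar>)) summable_on range int"
    using nat by (subst summable_on_reindex) (auto simp: o_def)
  moreover have "(\<lambda>n. exp (- \<bar>real_of_int n\<bar>)) summable_on range (\<lambda>n. - int n)"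
    using nat by (subst summable_on_reindex) (auto simp: o_def inj_def)
  ultimately have "(\<lambda>n. exp (- \<bar>real_of_int n\<bar>)) summable_on range int \<union> range (\<lambda>n. - int n)"
    by (intro summable_on_union)
  also have "range int \<union> range (\<lambda>n. - int n) = UNIV"
    by (auto simp: image_iff) (metis int_cases2)
  finally show ?thesis .
qed

text \<open>Negative quadratic growth in the exponent beats any linear term, so a constant multiple
  of \<open>exp (- \<bar>n\<bar>)\<close> dominates.\<close>

lemma summable_on_gaussian_bound:
  fixes f :: "int \<Rightarrow> complex" and \<alpha> \<beta> \<gamma> :: real
  assumes "\<alpha> > 0"
    and bound: "\<And>n. norm (f n) \<le> exp (\<gamma> + \<beta> * real_of_int n - \<alpha> * (real_of_int n)\<^sup>2)"
  shows "f summable_on UNIV"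
proof -
  \<comment> \<open>The summand \<open>\<bar>\<beta>\<bar>\<close> absorbs the linear term; the
    extra 1 leaves the decay \<open>- u\<close> after completing the square.\<close>
  define B where "B = \<bar>\<beta>\<bar> + 1"
  have "norm (f n) \<le> exp (\<gamma> + B\<^sup>2 / (4 * \<alpha>)) * exp (- \<bar>real_of_int n\<bar>)" for n
  proof -
    define u where "u = \<bar>real_of_int n\<bar>"
    have "0 \<le> (2 * \<alpha> * u - B)\<^sup>2 / (4 * \<alpha>)"
      using \<open>\<alpha> > 0\<close> by simp
    also have "\<dots> = \<alpha> * u\<^sup>2 - B * u + B\<^sup>2 / (4 * \<alpha>)"
      using \<open>\<alpha> > 0\<close> by (simp add: field_simps power2_eq_square)
    finally have "B * u - \<alpha> * u\<^sup>2 \<le> B\<^sup>2 / (4 * \<alpha>)" by simp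
    moreover have "\<beta> * real_of_int n \<le> \<bar>\<beta>\<bar> * u"
      unfolding u_def by (metis abs_ge_self abs_mult)
    ultimately have "\<gamma> + \<beta> * real_of_int n - \<alpha> * (real_of_int n)\<^sup>2 \<le> \<gamma> + B\<^sup>2 / (4 * \<alpha>) - u"
      by (simp add: B_def u_def algebra_simps)
    then have "exp (\<gamma> + \<beta> * real_of_int n - \<alpha> * (real_of_int n)\<^sup>2) \<le> exp (\<gamma> + B\<^sup>2 / (4 * \<alpha>) - u)"
      by simp
    with bound[of n] have "norm (f n) \<le> exp (\<gamma> + B\<^sup>2 / (4 * \<alpha>) - u)"
      by (rule order_trans)
    then show ?thesis
      by (simp add: exp_add[symmetric] u_def)
  qed
  moreover have "(\<lambda>n::int. exp (\<gamma> + B\<^sup>2 / (4 * \<alpha>)) * exp (- \<bar>real_of_int n\<bar>)) summable_on UNIV"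
    by (intro summable_on_cmult_right summable_on_exp_neg_abs_int)
  ultimately have "(\<lambda>n. norm (f n)) summable_on UNIV"
    by (intro Infinite_Sum.abs_summable_on_comparison_test') auto
  then show ?thesis
    by (simp add: summable_on_iff_abs_summable_on_complex)
qed

text \<open>The prefactor \<open>qpow \<tau> (1/4)\<close> is moved inside the sum, so that
  \<open>theta2\<close> becomes a plain series and products of theta functions expand
  termwise.\<close>

definition theta2_term :: "complex \<Rightarrow> complex \<Rightarrow> int \<Rightarrow> complex" where
  "theta2_term \<tau> z n =
     qpow \<tau> (1/4) * (qpow \<tau> (of_int (n * (n + 1))) * exp (of_int (2 * n + 1) * \<i> * z))"

definition theta4_term :: "complex \<Rightarrow> complex \<Rightarrow> int \<Rightarrow> complex" where
  "theta4_term \<tau> z n =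
     (-1) powi n * qpow \<tau> (of_int (n\<^sup>2)) * exp (of_int (2 * n) * \<i> * z)"

lemma theta2_eq_infsum: "theta2 z \<tau> = (\<Sum>\<^sub>\<infinity>n. theta2_term \<tau> z n)"
  by (simp add: theta2_def theta2_term_def infsum_cmult_right')

lemma theta4_eq_infsum: "theta4 z \<tau> = (\<Sum>\<^sub>\<infinity>n. theta4_term \<tau> z n)"
  by (simp add: theta4_def theta4_term_def)

lemma norm_qpow: "norm (qpow \<tau> \<alpha>) = exp (- (pi * \<alpha> * Im \<tau>))"
  by (simp add: qpow_def)

lemma norm_minus_one_powi [simp]: "norm ((-1 :: complex) powi k) = 1"
  by (simp add: norm_power_int)

lemma summable_theta2_term:
  assumes "Im \<tau> > 0"
  shows "theta2_term \<tau> z summable_on UNIV"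
proof (rule summable_on_gaussian_bound)
  show "pi * Im \<tau> > 0" using assms by simp
  \<comment> \<open>This is an equality: \<open>n * (n + 1) + 1/4\<close> and
    \<open>(2 * n + 1) * Im z\<close> are sorted by powers of \<open>n\<close>.\<close>
  show "norm (theta2_term \<tau> z n) \<le> exp ((- pi * Im \<tau> / 4 - Im z)
      + (- pi * Im \<tau> - 2 * Im z) * real_of_int n - pi * Im \<tau> * (real_of_int n)\<^sup>2)" for n
    by (simp add: theta2_term_def norm_mult norm_qpow exp_add[symmetric])
       (simp add: field_simps power2_eq_square)
qed

lemma summable_theta4_term:
  assumes "Im \<tau> > 0"
  shows "theta4_term \<tau> z summable_on UNIV"
proof (rule summable_on_gaussian_bound)
  show "pi * Im \<tau> > 0" using assms by simp
  show "norm (theta4_term \<tau> z n) \<le> exp (0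
      + (- 2 * Im z) * real_of_int n - pi * Im \<tau> * (real_of_int n)\<^sup>2)" for n
    by (simp add: theta4_term_def norm_mult norm_qpow exp_add[symmetric])
qed

section \<open>Expansion of the theta product\<close>

definition tuples :: "nat \<Rightarrow> nat \<Rightarrow> ((nat \<Rightarrow> int) \<times> (nat \<Rightarrow> int)) set" where
  "tuples a b = ({1..a} \<rightarrow>\<^sub>E UNIV) \<times> ({1..b} \<rightarrow>\<^sub>E UNIV)"

text \<open>This is the number N of the overview. For even \<open>a\<close>, \<open>a div 2\<close>
  is exactly half of \<open>a\<close>, so N stays an integer.\<close>

definition level :: "nat \<Rightarrow> nat \<Rightarrow> (nat \<Rightarrow> int) \<times> (nat \<Rightarrow> int) \<Rightarrow> int" where
  "level a b = (\<lambda>(r, s). (\<Sum>j=1..a. r j) + (\<Sum>i=1..b. s i) + int (a div 2))"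

definition R24_term ::
    "nat \<Rightarrow> nat \<Rightarrow> (nat \<Rightarrow> complex) \<Rightarrow> (nat \<Rightarrow> complex) \<Rightarrow> complex \<Rightarrow>
      (nat \<Rightarrow> int) \<times> (nat \<Rightarrow> int) \<Rightarrow> complex" where
  "R24_term a b x y \<tau> = (\<lambda>(r, s).
        (-1) powi (\<Sum>i=1..b. s i) *
        qpow \<tau> (of_int ((\<Sum>j=1..a. (r j)\<^sup>2) + (\<Sum>i=1..b. (s i)\<^sup>2) + (\<Sum>j=1..a. r j))) *
        exp (\<i> * ((\<Sum>j=1..a. 2 * of_int (r j) * x j) + (\<Sum>i=1..b. 2 * of_int (s i) * y i)
                  + (\<Sum>j=1..a. x j))))"

definition theta_product_term ::
    "nat \<Rightarrow> nat \<Rightarrow> (nat \<Rightarrow> complex) \<Rightarrow> (nat \<Rightarrow> complex) \<Rightarrow> complex \<Rightarrow> complex \<Rightarrow>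
      (nat \<Rightarrow> int) \<times> (nat \<Rightarrow> int) \<Rightarrow> complex" where
  "theta_product_term a b x y \<tau> w = (\<lambda>(r, s).
     (\<Prod>j=1..a. theta2_term \<tau> (w + x j) (r j)) * (\<Prod>i=1..b. theta4_term \<tau> (w + y i) (s i)))"

lemma R24_eq_infsum:
  "R24 m n a b x y \<tau> = of_nat (m * n) * qpow \<tau> (real a / 4) *
     infsum (R24_term a b x y \<tau>) (R24_index a b)"
  by (simp add: R24_def R24_term_def)

lemma R24_index_eq_level:
  assumes "even a"
  shows "R24_index a b = {p \<in> tuples a b. level a b p = 0}"
  using assms by (auto simp: R24_index_def tuples_def level_def elim!: evenE)

lemma qpow_add: "qpow \<tau> (\<alpha> + \<beta>) = qpow \<tau> \<alpha> * qpow \<tau> \<beta>"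
  by (simp add: qpow_def exp_add[symmetric] algebra_simps)

lemma qpow_sum: "finite A \<Longrightarrow> (\<Prod>j\<in>A. qpow \<tau> (f j)) = qpow \<tau> (\<Sum>j\<in>A. f j)"
  by (induction A rule: finite_induct) (simp_all add: qpow_add, simp add: qpow_def)

lemma qpow_of_nat_mult: "qpow (of_nat k * \<tau>) \<alpha> = qpow \<tau> (real k * \<alpha>)"
  by (simp add: qpow_def mult_ac)

lemma prod_minus_one_powi:
  "finite A \<Longrightarrow> (\<Prod>j\<in>A. (-1 :: complex) powi (f j)) = (-1) powi (\<Sum>j\<in>A. f j)"
  by (induction A rule: finite_induct) (simp_all add: power_int_add)

text \<open>Each factor contributes 1/4 and \<open>r j * (r j + 1)\<close> to the power of the nome,
  and \<open>2 * r j + 1\<close> to the coefficient of \<open>w\<close>. Collecting that coefficient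
  prepares the isolation of \<open>w\<close>.\<close>

lemma prod_theta2_term:
  "(\<Prod>j=1..a. theta2_term \<tau> (w + x j) (r j)) =
     qpow \<tau> (real a / 4) * qpow \<tau> (of_int ((\<Sum>j=1..a. (r j)\<^sup>2) + (\<Sum>j=1..a. r j))) *
     exp (\<i> * ((\<Sum>j=1..a. 2 * of_int (r j) * x j) + (\<Sum>j=1..a. x j)
       + of_int (2 * (\<Sum>j=1..a. r j) + int a) * w))"
proof -
  have "(\<Prod>j=1..a. qpow \<tau> (1/4)) = qpow \<tau> (real a / 4)"
    by (subst qpow_sum) simp_all
  moreover have "(\<Prod>j=1..a. qpow \<tau> (of_int (r j * (r j + 1)))) =
      qpow \<tau> (of_int ((\<Sum>j=1..a. (r j)\<^sup>2) + (\<Sum>j=1..a. r j)))"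
    by (subst qpow_sum) (simp_all add: algebra_simps power2_eq_square sum.distrib)
  moreover have "(\<Prod>j=1..a. exp (of_int (2 * r j + 1) * \<i> * (w + x j))) =
      exp (\<i> * ((\<Sum>j=1..a. 2 * of_int (r j) * x j) + (\<Sum>j=1..a. x j)
       + of_int (2 * (\<Sum>j=1..a. r j) + int a) * w))"
    by (subst exp_sum[symmetric])
       (simp_all add: algebra_simps sum.distrib sum_distrib_left sum_distrib_right)
  ultimately show ?thesis
    by (simp add: theta2_term_def prod.distrib del: of_int_sum of_int_add prod_constant)
qed

lemma prod_theta4_term:
  fixes b :: nat
  shows "(\<Prod>i=1..b. theta4_term \<tau> (w + y i) (s i)) =
     (-1) powi (\<Sum>i=1..b. s i) * qpow \<tau> (of_int (\<Sum>i=1..b. (s i)\<^sup>2)) *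
     exp (\<i> * ((\<Sum>i=1..b. 2 * of_int (s i) * y i) + of_int (2 * (\<Sum>i=1..b. s i)) * w))"
proof -
  have "(\<Prod>i=1..b. qpow \<tau> (of_int ((s i)\<^sup>2))) = qpow \<tau> (of_int (\<Sum>i=1..b. (s i)\<^sup>2))"
    by (subst qpow_sum) simp_all
  moreover have "(\<Prod>i=1..b. exp (of_int (2 * s i) * \<i> * (w + y i))) =
      exp (\<i> * ((\<Sum>i=1..b. 2 * of_int (s i) * y i) + of_int (2 * (\<Sum>i=1..b. s i)) * w))"
    by (subst exp_sum[symmetric])
       (simp_all add: algebra_simps sum.distrib sum_distrib_left sum_distrib_right)
  ultimately show ?thesis
    by (simp add: theta4_term_def prod.distrib prod_minus_one_powi del: of_int_sum of_int_power)
qed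

text \<open>The coefficients of \<open>w\<close> from the two kinds of theta factor add up to
  \<open>2 * level a b p\<close>, while everything independent of \<open>w\<close> is the summand of
  \<open>R24\<close> with its prefactor. A shift of \<open>w\<close> thus acts on each term by a
  scalar.\<close>

lemma theta_product_term_eq:
  assumes "even a"
  shows "theta_product_term a b x y \<tau> w p =
     qpow \<tau> (real a / 4) * R24_term a b x y \<tau> p * exp (2 * \<i> * of_int (level a b p) * w)"
proof -
  obtain r s where p: "p = (r, s)" by fastforce
  let ?r = "(\<Sum>j=1..a. 2 * of_int (r j) * x j) + (\<Sum>j=1..a. x j)"
  let ?s = "\<Sum>i=1..b. 2 * of_int (s i) * y i"
  have "int a = 2 * int (a div 2)" using assms by auto
  then have level: "2 * level a b p = (2 * (\<Sum>j=1..a. r j) + int a) + 2 * (\<Sum>i=1..b. s i)"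
    by (simp add: p level_def)
  have exps: "exp (\<i> * (?r + of_int (2 * (\<Sum>j=1..a. r j) + int a) * w)) *
      exp (\<i> * (?s + of_int (2 * (\<Sum>i=1..b. s i)) * w)) =
      exp (\<i> * ((\<Sum>j=1..a. 2 * of_int (r j) * x j) + ?s + (\<Sum>j=1..a. x j))
        + \<i> * of_int (2 * level a b p) * w)"
    unfolding level of_int_add[of "2 * (\<Sum>j=1..a. r j) + int a"] exp_add[symmetric]
    by (rule arg_cong[where f = exp]) (simp only: ring_distribs add_ac mult_ac)
  have powers: "qpow \<tau> (of_int ((\<Sum>j=1..a. (r j)\<^sup>2) + (\<Sum>j=1..a. r j))) *
      qpow \<tau> (of_int (\<Sum>i=1..b. (s i)\<^sup>2)) =
      qpow \<tau> (of_int ((\<Sum>j=1..a. (r j)\<^sup>2) + (\<Sum>i=1..b. (s i)\<^sup>2) + (\<Sum>j=1..a. r j)))"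
    by (simp only: qpow_add[symmetric] of_int_add add_ac)
  \<comment> \<open>Pairs the nome powers and the exponentials of the two products, in the shape
    that \<open>powers\<close> and \<open>exps\<close> rewrite.\<close>
  have regroup: "(A * u * v) * (B * u' * v') = A * (B * (u * u')) * (v * v')"
    for A B u u' v v' :: complex
    by simp
  show ?thesis
    unfolding theta_product_term_def p prod.case prod_theta2_term prod_theta4_term R24_term_def
      regroup powers exps[unfolded p]
    by (simp add: exp_add mult_ac del: of_int_add of_int_sum)
qed

lemma summable_theta_product_term:
  assumes "Im \<tau> > 0"
  shows "theta_product_term a b x y \<tau> w summable_on tuples a b"
  unfolding theta_product_term_def tuples_def
  using assms
  by (intro summable_on_Times_mult summable_on_prod_PiE summable_theta2_term summable_theta4_term)
     simp_all

text \<open>Absolute convergence permits multiplying out: first within each group of factors, then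
  across the two groups by Fubini.\<close>

lemma theta_product_eq_infsum:
  assumes "Im \<tau> > 0"
  shows "(\<Prod>j=1..a. theta2 (w + x j) \<tau>) * (\<Prod>i=1..b. theta4 (w + y i) \<tau>) =
    infsum (theta_product_term a b x y \<tau> w) (tuples a b)"
proof -
  have "(\<Prod>j=1..a. theta2 (w + x j) \<tau>) =
      (\<Sum>\<^sub>\<infinity>r\<in>{1..a} \<rightarrow>\<^sub>E UNIV. \<Prod>j=1..a. theta2_term \<tau> (w + x j) (r j))"
    unfolding theta2_eq_infsum using assms
    by (intro infsum_prod_PiE[symmetric] summable_on_prod_PiE summable_theta2_term) simp_all
  moreover have "(\<Prod>i=1..b. theta4 (w + y i) \<tau>) =
      (\<Sum>\<^sub>\<infinity>s\<in>{1..b} \<rightarrow>\<^sub>E UNIV. \<Prod>i=1..b. theta4_term \<tau> (w + y i) (s i))"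
    unfolding theta4_eq_infsum using assms
    by (intro infsum_prod_PiE[symmetric] summable_on_prod_PiE summable_theta4_term) simp_all
  ultimately show ?thesis
    using infsum_Times_mult[OF summable_theta_product_term[OF assms, of a b x y w,
        unfolded theta_product_term_def tuples_def]]
    unfolding theta_product_term_def tuples_def by simp
qed

section \<open>Averaging over the shifts\<close>

text \<open>Orthogonality of characters: the sum is geometric with ratio an \<open>M\<close>-th root
  of unity, equal to 1 exactly when \<open>M\<close> divides \<open>N\<close>. The factor 2 in the
  exponent is why shifts by pi over \<open>M\<close> suffice.\<close>

lemma sum_root_of_unity_powers:
  fixes M :: nat and N :: int
  assumes "M > 0"
  shows "(\<Sum>k<M. exp (2 * \<i> * of_int N * (of_nat k * of_real pi / of_nat M))) =
    (if int M dvd N then of_nat M else 0 :: complex)"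
proof -
  define \<omega> where "\<omega> = exp (2 * \<i> * of_int N * (of_real pi / of_nat M))"
  have "exp (2 * \<i> * of_int N * (of_nat k * of_real pi / of_nat M)) = \<omega> ^ k" for k
    unfolding \<omega>_def by (subst exp_of_nat_mult[symmetric]) (simp add: mult_ac)
  then have sum: "(\<Sum>k<M. exp (2 * \<i> * of_int N * (of_nat k * of_real pi / of_nat M))) = (\<Sum>k<M. \<omega> ^ k)"
    by simp
  have \<omega>1: "\<omega> = 1 \<longleftrightarrow> int M dvd N"
  proof -
    have "\<omega> = 1 \<longleftrightarrow> (\<exists>l::int. 2 * real_of_int N * (pi / real M) = of_int (2 * l) * pi)"
      unfolding \<omega>_def exp_eq_1 by simp
    also have "\<dots> \<longleftrightarrow> (\<exists>l::int. real_of_int N = of_int (int M * l))"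
      using assms by (simp add: field_simps)
    also have "\<dots> \<longleftrightarrow> int M dvd N"
      by (simp only: of_int_eq_iff dvd_def)
    finally show ?thesis .
  qed
  have "\<omega> ^ M = exp (\<i> * (of_int N * (of_real pi * 2)))"
    unfolding \<omega>_def using assms by (subst exp_of_nat_mult[symmetric]) (simp add: mult_ac)
  also have "\<dots> = 1"
    using exp_plus_2pin[of 0 N] by simp
  finally have "\<omega> ^ M = 1" .
  then show ?thesis
    unfolding sum using \<omega>1 by (auto simp: geometric_sum)
qed

lemma infsum_finite_sum:
  fixes f :: "'i \<Rightarrow> 'a \<Rightarrow> complex"
  assumes "finite K" and "\<And>k. k \<in> K \<Longrightarrow> f k summable_on A"
  shows "(\<Sum>k\<in>K. infsum (f k) A) = (\<Sum>\<^sub>\<infinity>p\<in>A. \<Sum>k\<in>K. f k p)"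
proof -
  have "((\<lambda>p. \<Sum>k\<in>K. f k p) has_sum (\<Sum>k\<in>K. infsum (f k) A)) A"
    using assms by (induction K rule: finite_induct) (auto intro!: has_sum_add has_sum_infsum)
  then show ?thesis by (simp add: infsumI)
qed

lemma S24_eq_infsum:
  assumes "Im \<tau> > 0" and "even a" and "m > 0" and "n > 0"
  shows "S24 m n a b x y \<tau> z = of_nat (m * n) *
    infsum (theta_product_term a b x y \<tau> z) {p \<in> tuples a b. int (m * n) dvd level a b p}"
proof -
  define M where "M = m * n"
  have M: "M > 0" using assms by (simp add: M_def)
  define w where "w k = z + of_nat k * of_real pi / of_nat M" for k
  have "S24 m n a b x y \<tau> z =
      (\<Sum>k<M. infsum (theta_product_term a b x y \<tau> (w k)) (tuples a b))"
    unfolding S24_def M_def[symmetric] w_def theta_product_eq_infsum[OF assms(1), symmetric]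
    by (simp add: add_ac)
  also have "\<dots> = (\<Sum>\<^sub>\<infinity>p\<in>tuples a b. \<Sum>k<M. theta_product_term a b x y \<tau> (w k) p)"
    using assms by (intro infsum_finite_sum summable_theta_product_term) simp_all
  also have "\<dots> = (\<Sum>\<^sub>\<infinity>p\<in>{p \<in> tuples a b. int M dvd level a b p}.
      of_nat M * theta_product_term a b x y \<tau> z p)"
  proof -
    have "(\<Sum>k<M. theta_product_term a b x y \<tau> (w k) p) =
        (if int M dvd level a b p then of_nat M else 0) * theta_product_term a b x y \<tau> z p" for p
    proof -
      \<comment> \<open>The shift only multiplies the term by a character of \<open>k\<close>, so
        the sum over \<open>k\<close> acts as a filter on the level.\<close>
      have "theta_product_term a b x y \<tau> (w k) p =
          exp (2 * \<i> * of_int (level a b p) * (of_nat k * of_real pi / of_nat M)) *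
          theta_product_term a b x y \<tau> z p" for k
        by (simp add: theta_product_term_eq[OF \<open>even a\<close>] w_def ring_distribs exp_add mult_ac)
      then have "(\<Sum>k<M. theta_product_term a b x y \<tau> (w k) p) =
          (\<Sum>k<M. exp (2 * \<i> * of_int (level a b p) * (of_nat k * of_real pi / of_nat M))) *
          theta_product_term a b x y \<tau> z p"
        by (simp only: sum_distrib_right)
      then show ?thesis
        by (simp only: sum_root_of_unity_powers[OF M])
    qed
    then show ?thesis
      by (intro infsum_cong_neutral) auto
  qed
  also have "\<dots> = of_nat M *
      infsum (theta_product_term a b x y \<tau> z) {p \<in> tuples a b. int M dvd level a b p}"
    by (rule infsum_cmult_right')
  finally show ?thesis by (simp only: M_def)
qed

section \<open>Translation to level zero\<close>

text \<open>The restricted abstractions keep the values outside the index ranges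
  \<open>undefined\<close>, so the result is always the unique representative of its tuple.\<close>

definition translate ::
    "nat \<Rightarrow> nat \<Rightarrow> int \<Rightarrow> (nat \<Rightarrow> int) \<times> (nat \<Rightarrow> int) \<Rightarrow> (nat \<Rightarrow> int) \<times> (nat \<Rightarrow> int)" where
  "translate a b c = (\<lambda>(r, s). (\<lambda>j\<in>{1..a}. r j + c, \<lambda>i\<in>{1..b}. s i + c))"

lemma translate_in_tuples: "translate a b c p \<in> tuples a b"
  by (auto simp: translate_def tuples_def split: prod.split)

lemma translate_translate: "translate a b c (translate a b d p) = translate a b (c + d) p"
  by (auto simp: translate_def fun_eq_iff split: prod.split)

lemma translate_0: "p \<in> tuples a b \<Longrightarrow> translate a b 0 p = p"
  by (auto simp: translate_def tuples_def PiE_restrict split: prod.splits)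

lemma level_translate: "level a b (translate a b c p) = level a b p + int (a + b) * c"
  by (auto simp: level_def translate_def sum.distrib algebra_simps split: prod.split)

text \<open>In the power of the nome the part linear in \<open>c\<close> is \<open>c\<close> times
  twice the level, hence zero. In the exponential the change is a multiple of the vanishing sum of
  all \<open>x j\<close> and \<open>y i\<close>. Only the square of \<open>c\<close> and the sign
  from the \<open>b\<close> entries of \<open>s\<close> survive.\<close>

lemma R24_term_translate:
  assumes "even a" and "level a b p = 0" and xy: "(\<Sum>j=1..a. x j) + (\<Sum>i=1..b. y i) = 0"
  shows "R24_term a b x y \<tau> (translate a b c p) =
    (-1) powi (int b * c) * qpow \<tau> (of_int (int (a + b) * c\<^sup>2)) * R24_term a b x y \<tau> p"
proof -
  obtain r s where p: "p = (r, s)" by fastforce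
  have "2 * ((\<Sum>j=1..a. r j) + (\<Sum>i=1..b. s i)) + int a = 0"
    using assms(1,2) by (auto simp: p level_def elim!: evenE)
  \<comment> \<open>Twice level zero, multiplied by \<open>c\<close> and solved for the contribution
    of the linear sum of the \<open>r j\<close>; it cancels the cross terms of the squares in
    \<open>quad\<close>.\<close>
  then have ic: "int a * c = - 2 * c * (\<Sum>j=1..a. r j) - 2 * c * (\<Sum>i=1..b. s i)"
    by algebra
  have sign: "(\<Sum>i=1..b. s i + c) = int b * c + (\<Sum>i=1..b. s i)"
    by (simp add: sum.distrib)
  have quad: "(\<Sum>j=1..a. (r j + c)\<^sup>2) + (\<Sum>i=1..b. (s i + c)\<^sup>2) + (\<Sum>j=1..a. r j + c) =
      int (a + b) * c\<^sup>2 + ((\<Sum>j=1..a. (r j)\<^sup>2) + (\<Sum>i=1..b. (s i)\<^sup>2) + (\<Sum>j=1..a. r j))"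
  proof -
    have "(\<Sum>j=1..a. (r j + c)\<^sup>2) = (\<Sum>j=1..a. (r j)\<^sup>2) + 2 * c * (\<Sum>j=1..a. r j) + int a * c\<^sup>2"
      by (simp add: power2_sum sum.distrib sum_distrib_left mult_ac)
    moreover have "(\<Sum>i=1..b. (s i + c)\<^sup>2) = (\<Sum>i=1..b. (s i)\<^sup>2) + 2 * c * (\<Sum>i=1..b. s i) + int b * c\<^sup>2"
      by (simp add: power2_sum sum.distrib sum_distrib_left mult_ac)
    moreover have "(\<Sum>j=1..a. r j + c) = (\<Sum>j=1..a. r j) + int a * c"
      by (simp add: sum.distrib)
    ultimately show ?thesis
      using ic by (simp add: ring_distribs)
  qed
  have "(\<Sum>j=1..a. 2 * of_int (r j + c) * x j) + (\<Sum>i=1..b. 2 * of_int (s i + c) * y i) =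
      (\<Sum>j=1..a. 2 * of_int (r j) * x j) + (\<Sum>i=1..b. 2 * of_int (s i) * y i)
      + 2 * of_int c * ((\<Sum>j=1..a. x j) + (\<Sum>i=1..b. y i))"
    by (simp add: sum.distrib sum_distrib_left algebra_simps)
  then have lin: "(\<Sum>j=1..a. 2 * of_int (r j + c) * x j) + (\<Sum>i=1..b. 2 * of_int (s i + c) * y i) =
      (\<Sum>j=1..a. 2 * of_int (r j) * x j) + (\<Sum>i=1..b. 2 * of_int (s i) * y i)"
    by (simp only: xy mult_zero_right add_0_right)
  have "R24_term a b x y \<tau> (translate a b c p) =
        (-1) powi (\<Sum>i=1..b. s i + c) *
        qpow \<tau> (of_int ((\<Sum>j=1..a. (r j + c)\<^sup>2) + (\<Sum>i=1..b. (s i + c)\<^sup>2) + (\<Sum>j=1..a. r j + c))) *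
        exp (\<i> * ((\<Sum>j=1..a. 2 * of_int (r j + c) * x j) + (\<Sum>i=1..b. 2 * of_int (s i + c) * y i)
                  + (\<Sum>j=1..a. x j)))"
    by (simp add: R24_term_def translate_def p del: of_int_add of_int_sum)
  also have "\<dots> = (-1) powi (int b * c) * qpow \<tau> (of_int (int (a + b) * c\<^sup>2)) * R24_term a b x y \<tau> p"
    unfolding sign quad lin R24_term_def p prod.case of_int_add[where ?'a = real] qpow_add
    by (simp add: power_int_add qpow_add)
  finally show ?thesis .
qed

text \<open>Translating by \<open>m * t\<close> raises the level by \<open>m * n * t\<close>, as
  there are \<open>n\<close> coordinates. Hence pairs of an integer \<open>t\<close> and a
  level-zero tuple parametrize the surviving tuples bijectively, and the summand splits into a
  factor in \<open>t\<close> and a factor in the tuple.\<close>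

lemma infsum_theta_product_term_multiples:
  assumes "Im \<tau> > 0" and "m > 0" and "n > 0" and "a + b = n" and "even a"
    and "(\<Sum>j=1..a. x j) + (\<Sum>i=1..b. y i) = 0"
  shows "infsum (theta_product_term a b x y \<tau> z) {p \<in> tuples a b. int (m * n) dvd level a b p} =
    qpow \<tau> (real a / 4) * infsum (R24_term a b x y \<tau>) (R24_index a b) *
    (\<Sum>\<^sub>\<infinity>t::int. (-1) powi (int (m * b) * t) * qpow (of_nat (m\<^sup>2 * n) * \<tau>) (of_int (t\<^sup>2)) *
       exp (of_int (2 * t) * \<i> * (of_nat (m * n) * z)))"
proof -
  let ?T = "{p \<in> tuples a b. int (m * n) dvd level a b p}"
  define G where "G t = (-1) powi (int (m * b) * t) * qpow (of_nat (m\<^sup>2 * n) * \<tau>) (of_int (t\<^sup>2)) *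
       exp (of_int (2 * t) * \<i> * (of_nat (m * n) * z))" for t :: int
  define H where "H p = qpow \<tau> (real a / 4) * R24_term a b x y \<tau> p" for p
  \<comment> \<open>\<open>j\<close> is the parametrization and \<open>i\<close> its inverse:
    \<open>t\<close> is read off as the level divided by \<open>m * n\<close>, then the translation
    is undone.\<close>
  define j where "j = (\<lambda>(t, p). translate a b (int m * t) p)"
  define i where "i p = (level a b p div int (m * n),
     translate a b (- (int m * (level a b p div int (m * n)))) p)" for p
  have level_j: "level a b (j (t, p)) = int (m * n) * t" if "p \<in> R24_index a b" for t p
    using that assms by (simp add: j_def level_translate R24_index_eq_level mult_ac)
  have 1: "i (j q) = q" if q_in: "q \<in> UNIV \<times> R24_index a b" for q
  proof -
    obtain t p where q: "q = (t, p)" "p \<in> R24_index a b" using q_in by blast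
    have "level a b (j q) div int (m * n) = t"
      using level_j[OF q(2)] q(1) assms by simp
    then show ?thesis
      using q assms
      by (simp add: i_def) (simp add: j_def translate_translate translate_0 R24_index_eq_level)
  qed
  have 2: "j q \<in> ?T" if q_in: "q \<in> UNIV \<times> R24_index a b" for q
  proof -
    obtain t p where q: "q = (t, p)" "p \<in> R24_index a b" using q_in by blast
    then show ?thesis
      using level_j[OF q(2), of t] by (simp add: j_def translate_in_tuples)
  qed
  have 3: "j (i p) = p" if "p \<in> ?T" for p
    using that by (simp add: i_def j_def translate_translate translate_0)
  have 4: "i p \<in> UNIV \<times> R24_index a b" if p_in: "p \<in> ?T" for p
  proof -
    obtain t where t: "level a b p = int (m * n) * t" using p_in by blast
    then have "level a b p div int (m * n) = t" using assms by simp
    then show ?thesis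
      using t assms by (simp add: i_def R24_index_eq_level translate_in_tuples level_translate)
  qed
  have 5: "theta_product_term a b x y \<tau> z (j q) = (case q of (t, p) \<Rightarrow> G t * H p)"
    if q_in: "q \<in> UNIV \<times> R24_index a b" for q
  proof -
    obtain t p where q: "q = (t, p)" "p \<in> R24_index a b" using q_in by blast
    have "level a b p = 0" using q assms by (simp add: R24_index_eq_level)
    then have "R24_term a b x y \<tau> (j q) = (-1) powi (int b * (int m * t)) *
        qpow \<tau> (of_int (int (a + b) * (int m * t)\<^sup>2)) * R24_term a b x y \<tau> p"
      unfolding j_def q prod.case using assms(5,6) by (intro R24_term_translate)
    \<comment> \<open>Source of the new period parameter: \<open>n * (m * t)^2\<close> equals
      \<open>m^2 * n * t^2\<close>.\<close>
    moreover have "qpow \<tau> (of_int (int (a + b) * (int m * t)\<^sup>2)) =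
        qpow (of_nat (m\<^sup>2 * n) * \<tau>) (of_int (t\<^sup>2))"
      unfolding qpow_of_nat_mult \<open>a + b = n\<close> by (simp add: power_mult_distrib mult_ac)
    ultimately have "R24_term a b x y \<tau> (j (t, p)) = (-1) powi (int (m * b) * t) *
        qpow (of_nat (m\<^sup>2 * n) * \<tau>) (of_int (t\<^sup>2)) * R24_term a b x y \<tau> p"
      by (simp only: q of_nat_mult mult_ac)
    then show ?thesis
      unfolding theta_product_term_eq[OF \<open>even a\<close>] q(1) level_j[OF q(2)] G_def H_def prod.case
      by (simp add: mult_ac)
  qed
  \<comment> \<open>Joint summability of the split terms is carried over from the expanded theta
    product through the bijection, which is what the factorization requires.\<close>
  have "theta_product_term a b x y \<tau> z summable_on ?T"
    using assms by (intro summable_on_subset_banach[OF summable_theta_product_term]) auto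
  also have "?this \<longleftrightarrow> (\<lambda>(t, p). G t * H p) summable_on UNIV \<times> R24_index a b"
    by (rule summable_on_reindex_bij_witness[of _ i j, symmetric]) (use 1 2 3 4 5 in auto)
  finally have summable: "(\<lambda>(t, p). G t * H p) summable_on UNIV \<times> R24_index a b" .
  have "infsum (theta_product_term a b x y \<tau> z) ?T =
      (\<Sum>\<^sub>\<infinity>(t, p)\<in>UNIV \<times> R24_index a b. G t * H p)"
    by (rule infsum_reindex_bij_witness[of _ i j, symmetric]) (use 1 2 3 4 5 in auto)
  also have "\<dots> = infsum G UNIV * infsum H (R24_index a b)"
    by (rule infsum_Times_mult[OF summable])
  also have "infsum H (R24_index a b) =
      qpow \<tau> (real a / 4) * infsum (R24_term a b x y \<tau>) (R24_index a b)"
    unfolding H_def by (rule infsum_cmult_right')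
  finally show ?thesis
    by (simp add: G_def[abs_def] mult_ac)
qed

section \<open>Identification of the remaining series by the parity of \<open>m * b\<close>\<close>

theorem theorem1p12:
  fixes \<tau> :: complex and m n a b :: nat and x y :: "nat \<Rightarrow> complex"
  assumes "Im \<tau> > 0"
    and "m > 0" and "n > 0"
    and "a + b = n" and "even a"
    and "(\<Sum>j=1..a. x j) + (\<Sum>i=1..b. y i) = 0"
  shows "\<forall>z::complex.
    (even (m * b) \<longrightarrow>
       S24 m n a b x y \<tau> z =
         R24 m n a b x y \<tau> * theta3 (of_nat (m * n) * z) (of_nat (m\<^sup>2 * n) * \<tau>)) \<and>
    (odd (m * b) \<longrightarrow>
       S24 m n a b x y \<tau> z =
         R24 m n a b x y \<tau> * theta4 (of_nat (m * n) * z) (of_nat (m\<^sup>2 * n) * \<tau>))"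
proof (intro allI conjI impI)
  fix z :: complex
  define \<Theta> where "\<Theta> = (\<Sum>\<^sub>\<infinity>t::int. (-1) powi (int (m * b) * t) *
    qpow (of_nat (m\<^sup>2 * n) * \<tau>) (of_int (t\<^sup>2)) * exp (of_int (2 * t) * \<i> * (of_nat (m * n) * z)))"
  have S: "S24 m n a b x y \<tau> z = R24 m n a b x y \<tau> * \<Theta>"
    unfolding S24_eq_infsum[OF assms(1,5,2,3)] infsum_theta_product_term_multiples[OF assms]
      R24_eq_infsum \<Theta>_def
    by (simp only: mult_ac)
  \<comment> \<open>With \<open>k = m * b\<close> the sign is constant for even \<open>k\<close> and
    alternates with \<open>t\<close> for odd \<open>k\<close>; this alone separates
    \<open>theta3\<close> from \<open>theta4\<close>.\<close>
  have sign: "(-1 :: complex) powi (int k * t) = (if even k then 1 else (-1) powi t)" for k t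
    by (simp add: power_int_mult)
  show "S24 m n a b x y \<tau> z =
      R24 m n a b x y \<tau> * theta3 (of_nat (m * n) * z) (of_nat (m\<^sup>2 * n) * \<tau>)" if "even (m * b)"
    unfolding S \<Theta>_def sign theta3_def using that by simp
  show "S24 m n a b x y \<tau> z =
      R24 m n a b x y \<tau> * theta4 (of_nat (m * n) * z) (of_nat (m\<^sup>2 * n) * \<tau>)" if "odd (m * b)"
    unfolding S \<Theta>_def sign theta4_def using that by simp
qed

end
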